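(* Let $n\ge 2$ and let $\mu$ be a positive Borel measure on $\mathbb{R}^n$ satisfying $\int_{\mathbb{R}^n}\prod_{\ell=1}^n\frac{1}{1+t_\ell^2}\,d\mu(\vec t)<\infty$. Let $g\colon(\mathbb{C}\setminus\mathbb{R})^n\to\mathbb{C}$ be defined by $$g(\vec z)=\frac{1}{\pi^n}\int_{\mathbb{R}^n}K_n(\vec z,\vec t)\,d\mu(\vec t).$$ Then, for any point $\vec z\in(\mathbb{C}\setminus\mathbb{R})^n$, we have $$g(\vec z)=(\mathrm{sgn}|I_-|-1)\sum_{D\subseteq C_-\cup C_+}(-1)^{|D|}\left(\overline{g(\Psi_D(\vec z))}+\overline{g(i\vec 1)}\right)+\overline{g(i\vec 1)},$$ where $C_+,C_-,I_+,I_-$ are the index sets associated to the point $\vec z$.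
   Context: $\mathbb{C}^{\pm}=\{z\in\mathbb{C}:\pm\mathrm{Im}\,z>0\}$, $i$ is the imaginary unit, and $i\vec 1=(i,\dots,i)$. The kernel is $$K_n(\vec z,\vec t):=i\left(\frac{2}{(2i)^n}\prod_{\ell=1}^n\left(\frac{1}{t_\ell-z_\ell}-\frac{1}{t_\ell+i}\right)-\frac{1}{(2i)^n}\prod_{\ell=1}^n\left(\frac{1}{t_\ell-i}-\frac{1}{t_\ell+i}\right)\right),$$ for $\vec z\in(\mathbb{C}\setminus\mathbb{R})^n$, $\vec t\in\mathbb{R}^n$; the integral defining $g$ converges absolutely for every $\vec z\in(\mathbb{C}\setminus\mathbb{R})^n$. To a vector $\vec z\in(\mathbb{C}\setminus\mathbb{R})^n$ one associates the pairwise disjoint sets of indices $C_+,I_+,I_-,C_-\subseteq\{1,\dots,n\}$ defined by: $\ell\in C_+\iff z_\ell\in\mathbb{C}^+\setminus\{i\}$; $\ell\in I_+\iff z_\ell=i$; $\ell\in C_-\iff z_\ell\in\mathbb{C}^-\setminus\{-i\}$; $\ell\in I_-\iff z_\ell=-i$. For a set $B\subseteq\{1,\dots,n\}$ the map $\Psi_B\colon\mathbb{C}^n\to\mathbb{C}^n$ is $\Psi_B(\vec z)=\vec\zeta$ with $\zeta_\ell=\overline{z_\ell}$ if $\ell\in B$ and $\zeta_\ell=i$ otherwise. $|\cdot|$ denotes cardinality of a set, $\mathrm{sgn}(0)=0$ and $\mathrm{sgn}(m)=1$ for $m>0$. The sum runs over all subsets $D$ of $C_-\cup C_+$, including the empty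 set. *)

theory Defs
  imports "HOL-Analysis.Analysis"
begin

definition cplus :: "complex set" where
  "cplus = {z. Im z > 0}"

definition cminus :: "complex set" where
  "cminus = {z. Im z < 0}"

definition off_real :: "(complex ^ 'n) set" where
  "off_real = {z. \<forall>l. z $ l \<notin> \<real>}"

definition i_vec :: "complex ^ 'n" where
  "i_vec = (\<chi> l. \<i>)"

definition K_kernel :: "complex ^ 'n \<Rightarrow> real ^ 'n \<Rightarrow> complex" where
  "K_kernel z t =
     \<i> * (2 / (2 * \<i>) ^ CARD('n) *
            (\<Prod>l\<in>UNIV. 1 / (of_real (t $ l) - z $ l) - 1 / (of_real (t $ l) + \<i>))
          - 1 / (2 * \<i>) ^ CARD('n) *
            (\<Prod>l\<in>UNIV. 1 / (of_real (t $ l) - \<i>) - 1 / (of_real (t $ l) + \<i>)))"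

definition C_plus :: "complex ^ 'n \<Rightarrow> 'n set" where
  "C_plus z = {l. z $ l \<in> cplus - {\<i>}}"

definition I_plus :: "complex ^ 'n \<Rightarrow> 'n set" where
  "I_plus z = {l. z $ l = \<i>}"

definition C_minus :: "complex ^ 'n \<Rightarrow> 'n set" where
  "C_minus z = {l. z $ l \<in> cminus - {- \<i>}}"

definition I_minus :: "complex ^ 'n \<Rightarrow> 'n set" where
  "I_minus z = {l. z $ l = - \<i>}"

definition Psi :: "'n set \<Rightarrow> complex ^ 'n \<Rightarrow> complex ^ 'n" where
  "Psi B z = (\<chi> l. if l \<in> B then cnj (z $ l) else \<i>)"

end

theory Submission
  imports Defs
begin

text \<open>
  The kernel is built from the one-variable functions
  \<open>p\<^sub>z(t) = (1/(t - z) - 1/(t + \<i>)) / (2\<i>)\<close>: writing \<open>q = p\<^sub>\<i> = 1/(1 + t\<^sup>2)\<close>, it equals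
  \<open>\<i> (2 \<Prod> p\<^sub>z - \<Prod> q)\<close>, the products being over the coordinates.
  Everything rests on the reflection formula \<open>cnj p\<^bsub>cnj z\<^esub> = q - p\<^sub>z\<close>, together with \<open>q\<close> being
  real and \<open>p\<^bsub>-\<i>\<^esub> = 0\<close>.

  Put \<open>C = C\<^sub>- \<union> C\<^sub>+\<close>. Conjugating the kernel at \<open>\<Psi>\<^sub>D z\<close> and adding the conjugated kernel at
  \<open>(\<i>, \<dots>, \<i>)\<close> cancels the term \<open>\<Prod> q\<close> and leaves
  \<open>-2\<i>\<close> times the product of \<open>q - p\<^sub>z\<close> over \<open>D\<close> and of \<open>q\<close> off \<open>D\<close>. The alternating sum over
  \<open>D \<subseteq> C\<close> is the expansion of a product: over \<open>C\<close> each factor becomes \<open>q - (q - p\<^sub>z) = p\<^sub>z\<close>,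
  and off \<open>C\<close> the factor \<open>q\<close> remains. If no coordinate of \<open>z\<close> is \<open>-\<i>\<close>, then off \<open>C\<close> we have
  \<open>q = p\<^sub>z\<close>, so the sum is \<open>-2\<i> \<Prod> p\<^sub>z\<close> and its negative supplies the first term of the kernel.
  If some coordinate is \<open>-\<i>\<close>, then \<open>\<Prod> p\<^sub>z = 0\<close>, and the prefactor \<open>sgn |I\<^sub>-| - 1\<close> removes the
  sum. In both cases \<open>-\<i> \<Prod> q\<close>, the conjugated kernel at \<open>(\<i>, \<dots>, \<i>)\<close>, is the
  other term (\<open>K_kernel_conjugate_expansion\<close>).

  So the claimed identity already holds for the kernel pointwise in \<open>t\<close>, and it only has to be
  integrated. This is legitimate because \<open>p\<^sub>z = O(1/(1 + t\<^sup>2))\<close>, which makes each kernel integrable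
  (\<open>integrable_K_kernel\<close>).
\<close>

definition cauchy_factor :: "complex \<Rightarrow> real \<Rightarrow> complex" where
  "cauchy_factor z t = (1 / (of_real t - z) - 1 / (of_real t + \<i>)) / (2 * \<i>)"

lemma of_real_diff_nonreal_nonzero:
  assumes "z \<notin> \<real>"
  shows "complex_of_real t - z \<noteq> 0"
  using assms by (metis Reals_of_real eq_iff_diff_eq_0)

lemma of_real_plus_i_nonzero: "complex_of_real t + \<i> \<noteq> 0"
  by (simp add: complex_eq_iff)

lemma cauchy_factor_i: "cauchy_factor \<i> t = of_real (1 / (1 + t\<^sup>2))"
proof -
  have "complex_of_real t - \<i> \<noteq> 0"
    by (simp add: complex_eq_iff)
  moreover have "1 + (complex_of_real t)\<^sup>2 = (of_real t - \<i>) * (of_real t + \<i>)"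
    by (simp add: algebra_simps power2_eq_square)
  ultimately show ?thesis
    using of_real_plus_i_nonzero[of t]
    by (simp add: cauchy_factor_def divide_simps)
qed

lemma cauchy_factor_minus_i: "cauchy_factor (- \<i>) t = 0"
  by (simp add: cauchy_factor_def)

text \<open>
  Conjugation moves the reference pole from \<open>-\<i>\<close> to \<open>\<i>\<close>, and \<open>cauchy_factor \<i>\<close> is exactly the
  correction that moves it back; the minus sign comes from \<open>cnj (2 * \<i>) = - (2 * \<i>)\<close>.
\<close>

lemma cnj_cauchy_factor_cnj:
  "cnj (cauchy_factor (cnj z) t) = cauchy_factor \<i> t - cauchy_factor z t"
  by (simp add: cauchy_factor_def field_simps)

text \<open>
  The difference of the two poles is \<open>(z + \<i>) / ((t - z) (t + \<i>))\<close>, and \<open>\<bar>t + \<i>\<bar> / \<bar>t - z\<bar>\<close> stays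
  bounded in \<open>t\<close>, since \<open>\<bar>t + \<i>\<bar> \<le> \<bar>t - z\<bar> + \<bar>z + \<i>\<bar>\<close> while \<open>\<bar>t - z\<bar>\<close> is at least \<open>\<bar>Im z\<bar>\<close>.
\<close>

lemma cauchy_factor_bound:
  assumes "z \<notin> \<real>"
  shows "norm (cauchy_factor z t)
           \<le> norm (z + \<i>) * (1 + norm (z + \<i>) / \<bar>Im z\<bar>) * (1 / (1 + t\<^sup>2))"
proof -
  let ?a = "norm (complex_of_real t - z)" and ?b = "norm (complex_of_real t + \<i>)"
  have Im: "\<bar>Im z\<bar> > 0"
    using assms by (simp add: complex_is_Real_iff)
  have a: "\<bar>Im z\<bar> \<le> ?a"
    using abs_Im_le_cmod[of "complex_of_real t - z"] by simp
  have b: "?b > 0"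
    using of_real_plus_i_nonzero[of t] by simp
  have b2: "?b\<^sup>2 = 1 + t\<^sup>2"
    by (simp add: cmod_power2)
  have "?b \<le> ?a + norm (z + \<i>)"
    using norm_triangle_ineq[of "complex_of_real t - z" "z + \<i>"] by simp
  also have "\<dots> \<le> ?a + norm (z + \<i>) * (?a / \<bar>Im z\<bar>)"
    using Im a mult_left_mono[of 1 "?a / \<bar>Im z\<bar>" "norm (z + \<i>)"] by simp
  finally have ratio: "?b \<le> (1 + norm (z + \<i>) / \<bar>Im z\<bar>) * ?a"
    by (simp add: algebra_simps)
  have "1 / ?a \<le> (1 + norm (z + \<i>) / \<bar>Im z\<bar>) / ?b"
    using ratio Im a b by (simp add: divide_simps mult.commute)
  then have "1 / ?a * (1 / ?b) \<le> (1 + norm (z + \<i>) / \<bar>Im z\<bar>) / ?b * (1 / ?b)"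
    using b by (intro mult_right_mono) auto
  also have "\<dots> = (1 + norm (z + \<i>) / \<bar>Im z\<bar>) * (1 / (1 + t\<^sup>2))"
    using b2 by (simp add: power2_eq_square)
  finally have main: "1 / ?a * (1 / ?b) \<le> (1 + norm (z + \<i>) / \<bar>Im z\<bar>) * (1 / (1 + t\<^sup>2))" .
  have "cauchy_factor z t = (z + \<i>) / ((of_real t - z) * (of_real t + \<i>)) / (2 * \<i>)"
    using of_real_diff_nonreal_nonzero[OF assms, of t] of_real_plus_i_nonzero[of t]
    by (simp add: cauchy_factor_def divide_simps)
  then have "norm (cauchy_factor z t) = norm (z + \<i>) * (1 / ?a * (1 / ?b)) / 2"
    by (simp add: norm_divide norm_mult)
  also have "\<dots> \<le> norm (z + \<i>) * (1 / ?a * (1 / ?b))"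
    using divide_left_mono[of 1 2 "norm (z + \<i>) * (1 / ?a * (1 / ?b))"] by simp
  also have "\<dots> \<le> norm (z + \<i>) * ((1 + norm (z + \<i>) / \<bar>Im z\<bar>) * (1 / (1 + t\<^sup>2)))"
    by (rule mult_left_mono[OF main]) simp
  finally show ?thesis
    by (simp only: mult.assoc)
qed

lemma K_kernel_eq_cauchy_factors:
  fixes z :: "complex ^ 'n"
  shows "K_kernel z t = \<i> * (2 * (\<Prod>l\<in>UNIV. cauchy_factor (z $ l) (t $ l))
                              - (\<Prod>l\<in>UNIV. cauchy_factor \<i> (t $ l)))"
  unfolding K_kernel_def cauchy_factor_def prod_dividef prod_constant by simp

lemma i_vec_off_real: "i_vec \<in> off_real"
  by (simp add: i_vec_def off_real_def complex_is_Real_iff)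

lemma Psi_off_real: "z \<in> off_real \<Longrightarrow> Psi D z \<in> off_real"
  by (simp add: Psi_def off_real_def complex_is_Real_iff)

lemma integrable_K_kernel:
  fixes \<mu> :: "(real ^ 'n) measure" and w :: "complex ^ 'n"
  assumes sets: "sets \<mu> = sets borel"
    and fin: "(\<integral>\<^sup>+ t. ennreal (\<Prod>l\<in>UNIV. 1 / (1 + (t $ l)\<^sup>2)) \<partial>\<mu>) < \<infinity>"
    and w: "w \<in> off_real"
  shows "integrable \<mu> (K_kernel w)"
proof -
  note [measurable_cong] = sets
  let ?Q = "\<lambda>t :: real ^ 'n. \<Prod>l\<in>UNIV. 1 / (1 + (t $ l)\<^sup>2)"
  have Q: "integrable \<mu> ?Q"
  proof (rule integrableI_bounded)
    show "?Q \<in> borel_measurable \<mu>"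
      by measurable
    show "(\<integral>\<^sup>+ t. ennreal (norm (?Q t)) \<partial>\<mu>) < \<infinity>"
      using fin by (simp add: abs_prod)
  qed
  have factors: "integrable \<mu> (\<lambda>t. \<Prod>l\<in>UNIV. cauchy_factor (v $ l) (t $ l))"
    if v: "v \<in> off_real" for v :: "complex ^ 'n"
  proof (rule Bochner_Integration.integrable_bound)
    let ?M = "\<lambda>l. norm (v $ l + \<i>) * (1 + norm (v $ l + \<i>) / \<bar>Im (v $ l)\<bar>)"
    show "integrable \<mu> (\<lambda>t. (\<Prod>l\<in>UNIV. ?M l) * ?Q t)"
      using Q by simp
    show "(\<lambda>t. \<Prod>l\<in>UNIV. cauchy_factor (v $ l) (t $ l)) \<in> borel_measurable \<mu>"
      unfolding cauchy_factor_def by measurable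
    have "norm (\<Prod>l\<in>UNIV. cauchy_factor (v $ l) (t $ l)) \<le> norm ((\<Prod>l\<in>UNIV. ?M l) * ?Q t)"
      for t :: "real ^ 'n"
    proof -
      have "norm (\<Prod>l\<in>UNIV. cauchy_factor (v $ l) (t $ l))
              = (\<Prod>l\<in>UNIV. norm (cauchy_factor (v $ l) (t $ l)))"
        by (simp add: prod_norm)
      also have "\<dots> \<le> (\<Prod>l\<in>UNIV. ?M l * (1 / (1 + (t $ l)\<^sup>2)))"
        using v by (intro prod_mono conjI norm_ge_zero cauchy_factor_bound) (simp add: off_real_def)
      also have "\<dots> = (\<Prod>l\<in>UNIV. ?M l) * ?Q t"
        by (rule prod.distrib)
      also have "\<dots> \<le> norm \<dots>"
        by simp
      finally show ?thesis .
    qed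
    then show "AE t in \<mu>. norm (\<Prod>l\<in>UNIV. cauchy_factor (v $ l) (t $ l))
                  \<le> norm ((\<Prod>l\<in>UNIV. ?M l) * ?Q t)"
      by simp
  qed
  have "integrable \<mu> (\<lambda>t. \<Prod>l\<in>UNIV. cauchy_factor \<i> (t $ l))"
    using factors[OF i_vec_off_real] by (simp add: i_vec_def)
  then show ?thesis
    using factors[OF w] by (simp add: K_kernel_eq_cauchy_factors[abs_def])
qed

text \<open>
  Expanding \<open>\<Prod>\<^bsub>C\<^esub> (a - (a - b))\<close> over the set \<open>D\<close> of coordinates from which \<open>a - b\<close> is chosen
  gives the alternating sum; the product of \<open>a\<close> off \<open>C\<close> is common to all summands.
\<close>

lemma alternating_sum_prod_diff:
  fixes a b :: "'n::finite \<Rightarrow> 'a::comm_ring_1"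
  shows "(\<Sum>D\<in>Pow C. (-1) ^ card D * (\<Prod>l\<in>UNIV. if l \<in> D then a l - b l else a l))
           = (\<Prod>l\<in>UNIV. if l \<in> C then b l else a l)"
proof -
  have split: "(\<Prod>l\<in>UNIV. if l \<in> D then x l else a l) = (\<Prod>l\<in>D. x l) * (\<Prod>l\<in>C - D. a l) * (\<Prod>l\<in>- C. a l)"
    if "D \<subseteq> C" for D and x :: "'n \<Rightarrow> 'a"
  proof -
    have "(\<Prod>l\<in>UNIV. if l \<in> D then x l else a l) = (\<Prod>l\<in>D. x l) * (\<Prod>l\<in>- D. a l)"
      by (simp add: prod.If_cases)
    moreover have "- D = (C - D) \<union> - C"
      using that by auto
    then have "(\<Prod>l\<in>- D. a l) = (\<Prod>l\<in>C - D. a l) * (\<Prod>l\<in>- C. a l)"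
      by (simp only:) (rule prod.union_disjoint; auto)
    ultimately show ?thesis
      by (simp add: mult.assoc)
  qed
  have "(\<Sum>D\<in>Pow C. (-1) ^ card D * (\<Prod>l\<in>UNIV. if l \<in> D then a l - b l else a l))
          = (\<Prod>l\<in>C. a l - (a l - b l)) * (\<Prod>l\<in>- C. a l)"
    by (subst prod_diff_conv_sum[OF finite], unfold sum_distrib_right, intro sum.cong refl)
      (simp add: split mult.assoc)
  also have "\<dots> = (\<Prod>l\<in>UNIV. if l \<in> C then b l else a l)"
    using split[of C b] by simp
  finally show ?thesis .
qed

lemma cnj_K_kernel_i_vec:
  fixes t :: "real ^ 'n"
  shows "cnj (K_kernel i_vec t) = - \<i> * (\<Prod>l\<in>UNIV. cauchy_factor \<i> (t $ l))"
  by (simp add: K_kernel_eq_cauchy_factors i_vec_def cauchy_factor_i)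

text \<open>
  The kernel is not a pure product, so the product expansion does not apply to it directly.
  Adding the conjugate kernel at \<open>(\<i>, \<dots>, \<i>)\<close> cancels the term that does not depend on \<open>z\<close>.
\<close>

lemma cnj_K_kernel_Psi:
  fixes z :: "complex ^ 'n"
  shows "cnj (K_kernel (Psi D z) t) + cnj (K_kernel i_vec t)
      = - 2 * \<i> * (\<Prod>l\<in>UNIV. if l \<in> D then cauchy_factor \<i> (t $ l) - cauchy_factor (z $ l) (t $ l)
                              else cauchy_factor \<i> (t $ l))"
proof -
  have "cnj (cauchy_factor (Psi D z $ l) (t $ l))
      = (if l \<in> D then cauchy_factor \<i> (t $ l) - cauchy_factor (z $ l) (t $ l)
         else cauchy_factor \<i> (t $ l))" for l
    by (simp add: Psi_def cnj_cauchy_factor_cnj) (simp add: cauchy_factor_i)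
  moreover have "cnj (cauchy_factor \<i> (t $ l)) = cauchy_factor \<i> (t $ l)" for l
    by (simp add: cauchy_factor_i)
  ultimately show ?thesis
    by (simp add: cnj_K_kernel_i_vec K_kernel_eq_cauchy_factors[of "Psi D z"] algebra_simps)
qed

text \<open>
  The proposition before integration. The two cases differ because the alternating sum returns
  \<open>cauchy_factor \<i>\<close> at every coordinate outside \<open>C_minus z \<union> C_plus z\<close>: this is the right factor
  where \<open>z\<close> equals \<open>\<i>\<close>, but not where it equals \<open>-\<i>\<close>.
\<close>

theorem K_kernel_conjugate_expansion:
  fixes z :: "complex ^ 'n"
  assumes z: "z \<in> off_real"
  shows "K_kernel z t =
    (of_real (sgn (real (card (I_minus z)))) - 1) *
      (\<Sum>D\<in>Pow (C_minus z \<union> C_plus z).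
         (-1) ^ card D * (cnj (K_kernel (Psi D z) t) + cnj (K_kernel i_vec t)))
    + cnj (K_kernel i_vec t)"
proof (cases "I_minus z = {}")
  case True
  let ?C = "C_minus z \<union> C_plus z"
  have off: "z $ l = \<i>" if "l \<notin> ?C" for l
  proof -
    have "Im (z $ l) \<noteq> 0" "z $ l \<noteq> - \<i>"
      using z True by (auto simp: off_real_def I_minus_def complex_is_Real_iff)
    with that show ?thesis
      by (auto simp: C_minus_def C_plus_def cplus_def cminus_def)
  qed
  have "(\<Sum>D\<in>Pow ?C. (-1) ^ card D * (cnj (K_kernel (Psi D z) t) + cnj (K_kernel i_vec t)))
      = - 2 * \<i> * (\<Sum>D\<in>Pow ?C. (-1) ^ card D *
          (\<Prod>l\<in>UNIV. if l \<in> D then cauchy_factor \<i> (t $ l) - cauchy_factor (z $ l) (t $ l)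
                       else cauchy_factor \<i> (t $ l)))"
    by (simp only: cnj_K_kernel_Psi sum_distrib_left mult.left_commute)
  also have "\<dots> = - 2 * \<i> * (\<Prod>l\<in>UNIV. if l \<in> ?C then cauchy_factor (z $ l) (t $ l)
                              else cauchy_factor \<i> (t $ l))"
    by (simp only: alternating_sum_prod_diff)
  also have "(\<Prod>l\<in>UNIV. if l \<in> ?C then cauchy_factor (z $ l) (t $ l) else cauchy_factor \<i> (t $ l))
      = (\<Prod>l\<in>UNIV. cauchy_factor (z $ l) (t $ l))"
    using off by (intro prod.cong) auto
  finally show ?thesis
    using True by (simp add: cnj_K_kernel_i_vec K_kernel_eq_cauchy_factors[of z] algebra_simps)
next
  case False
  then obtain k where "z $ k = - \<i>"
    by (auto simp: I_minus_def)
  then have "(\<Prod>l\<in>UNIV. cauchy_factor (z $ l) (t $ l)) = 0"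
    by (intro prod_zero bexI[of _ k]) (simp_all add: cauchy_factor_minus_i)
  moreover have "card (I_minus z) > 0"
    using False by (simp add: card_gt_0_iff)
  ultimately show ?thesis
    by (simp add: cnj_K_kernel_i_vec K_kernel_eq_cauchy_factors[of z] del: prod_zero_iff)
qed

theorem proposition6p2:
  fixes \<mu> :: "(real ^ 'n) measure"
    and g :: "complex ^ 'n \<Rightarrow> complex"
    and z :: "complex ^ 'n"
  assumes "CARD('n) \<ge> 2"
    and "sets \<mu> = sets borel"
    and "(\<integral>\<^sup>+ t. ennreal (\<Prod>l\<in>UNIV. 1 / (1 + (t $ l)\<^sup>2)) \<partial>\<mu>) < \<infinity>"
    and "\<And>w. w \<in> off_real \<Longrightarrow>
           g w = 1 / of_real pi ^ CARD('n) * (\<integral>t. K_kernel w t \<partial>\<mu>)"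
    and "z \<in> off_real"
  shows "g z =
    (of_real (sgn (real (card (I_minus z)))) - 1) *
      (\<Sum>D\<in>Pow (C_minus z \<union> C_plus z).
         (-1) ^ card D * (cnj (g (Psi D z)) + cnj (g i_vec)))
    + cnj (g i_vec)"
proof -
  let ?c = "1 / complex_of_real pi ^ CARD('n)"
  let ?s = "complex_of_real (sgn (real (card (I_minus z)))) - 1"
  let ?P = "Pow (C_minus z \<union> C_plus z)"
  have cnj_integrable: "integrable \<mu> (\<lambda>t. cnj (K_kernel w t))" if "w \<in> off_real" for w
    using integrable_K_kernel[OF assms(2,3) that] by simp
  have cnj_g: "cnj (g w) = ?c * (\<integral>t. cnj (K_kernel w t) \<partial>\<mu>)" if "w \<in> off_real" for w
    using assms(4)[OF that] by simp
  note int = cnj_integrable[OF Psi_off_real[OF assms(5)]] cnj_integrable[OF i_vec_off_real]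
  have "(\<integral>t. K_kernel z t \<partial>\<mu>) =
      (\<integral>t. ?s * (\<Sum>D\<in>?P. (-1) ^ card D * (cnj (K_kernel (Psi D z) t) + cnj (K_kernel i_vec t)))
            + cnj (K_kernel i_vec t) \<partial>\<mu>)"
    by (rule Bochner_Integration.integral_cong[OF refl K_kernel_conjugate_expansion[OF assms(5)]])
  also have "\<dots> = ?s * (\<Sum>D\<in>?P. (-1) ^ card D * ((\<integral>t. cnj (K_kernel (Psi D z) t) \<partial>\<mu>)
                                                 + (\<integral>t. cnj (K_kernel i_vec t) \<partial>\<mu>)))
            + (\<integral>t. cnj (K_kernel i_vec t) \<partial>\<mu>)"
    using int by simp
  finally have "g z = ?c * (?s * (\<Sum>D\<in>?P. (-1) ^ card D * ((\<integral>t. cnj (K_kernel (Psi D z) t) \<partial>\<mu>)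
                                                 + (\<integral>t. cnj (K_kernel i_vec t) \<partial>\<mu>)))
            + (\<integral>t. cnj (K_kernel i_vec t) \<partial>\<mu>))"
    using assms(4)[OF assms(5)] by simp
  then show ?thesis
    unfolding cnj_g[OF Psi_off_real[OF assms(5)]] cnj_g[OF i_vec_off_real]
    by (simp only: distrib_left sum_distrib_left mult.left_commute)
qed

end
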